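(* Assume the continuum hypothesis. Let $\mathcal{T}$ be the density topology on $\mathbf{R}$. Then there is a subset $S \subseteq \mathbf{R}$ of cardinality $2^{\aleph_0}$ which is dense in $(\mathbf{R},\mathcal{T})$ and which, with the subspace topology inherited from $(\mathbf{R},\mathcal{T})$, is hereditarily orthocompact.
   Context: Density topology: let $m$ denote Lebesgue measure. A Lebesgue measurable set $E \subseteq \mathbf{R}$ has density $d$ at $x \in \mathbf{R}$ if $\lim_{h \to 0^+} \frac{m(E \cap [x-h,x+h])}{2h}$ exists and equals $d$. Let $\phi(E)$ be the set of $x\in\mathbf{R}$ at which $E$ has density $1$. The open sets of the density topology $\mathcal{T}$ on $\mathbf{R}$ are the measurable sets $E$ with $E \subseteq \phi(E)$. A family $\mathcal{U}$ of open subsets of a topological space is interior preserving if $\bigcap \mathcal{V}$ is open for every $\mathcal{V} \subseteq \mathcal{U}$. A topological space $X$ is orthocompact if every open cover of $X$ has an interior-preserving open refinement (again covering $X$). A space is hereditarily orthocompact if every subspace of it is orthocompact. *)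

theory Defs
  imports "HOL-Analysis.Analysis"
begin

unbundle cardinal_syntax

section \<open>The density topology on the real line\<close>

definition has_density :: "real set \<Rightarrow> real \<Rightarrow> real \<Rightarrow> bool" where
  "has_density E d x \<longleftrightarrow>
     ((\<lambda>h. measure lebesgue (E \<inter> {x - h..x + h}) / (2 * h)) \<longlongrightarrow> d) (at_right 0)"

definition density_points :: "real set \<Rightarrow> real set" where
  "density_points E = {x. has_density E 1 x}"

text \<open>The value of \<^const>\<open>measure\<close> on a non-measurable set is junk, so the two definitions above are
  meaningful only for Lebesgue measurable \<open>E\<close>. This is imposed explicitly here.\<close>

definition density_open :: "real set \<Rightarrow> bool" where
  "density_open E \<longleftrightarrow> E \<in> sets lebesgue \<and> E \<subseteq> density_points E"

definition density_topology :: "real topology" where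
  "density_topology = topology density_open"

text \<open>The remainder of this section shows that the density open sets do form a topology, so that
  \<^const>\<open>density_topology\<close> is not an unspecified value of the type; see
  \<open>openin_density_topology\<close> below.\<close>

lemma lmeasurable_Int_Icc:
  fixes a b :: real
  assumes "E \<in> sets lebesgue"
  shows "E \<inter> {a..b} \<in> lmeasurable"
  using fmeasurable_Int_fmeasurable[of "{a..b}" lebesgue E] assms
  by (simp add: Int_commute)

lemma has_density_1_mono:
  assumes F: "F \<in> sets lebesgue"
    and le: "\<And>h. h > 0 \<Longrightarrow> f h \<le> measure lebesgue (F \<inter> {x - h..x + h}) / (2 * h)"
    and lim: "(f \<longlongrightarrow> 1) (at_right 0)"
  shows "has_density F 1 x"
  unfolding has_density_def
proof (rule tendsto_sandwich[OF _ _ lim tendsto_const])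
  show "\<forall>\<^sub>F h in at_right 0. f h \<le> measure lebesgue (F \<inter> {x - h..x + h}) / (2 * h)"
    using eventually_at_right_less[of "0::real"] by eventually_elim (rule le)
  show "\<forall>\<^sub>F h in at_right 0. measure lebesgue (F \<inter> {x - h..x + h}) / (2 * h) \<le> 1"
    using eventually_at_right_less[of "0::real"]
  proof eventually_elim
    case (elim h)
    have "measure lebesgue (F \<inter> {x - h..x + h}) \<le> measure lebesgue {x - h..x + h}"
      by (rule measure_mono_fmeasurable) (use lmeasurable_Int_Icc[OF F] in auto)
    then show ?case using elim by (simp add: field_simps)
  qed
qed

lemma density_open_Int:
  assumes "density_open E" "density_open F"
  shows "density_open (E \<inter> F)"
proof -
  have E: "E \<in> sets lebesgue" and F: "F \<in> sets lebesgue"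
    using assms by (auto simp: density_open_def)
  have "has_density (E \<inter> F) 1 x" if x: "x \<in> E" "x \<in> F" for x
  proof (rule has_density_1_mono)
    let ?r = "\<lambda>G h. measure lebesgue (G \<inter> {x - h..x + h}) / (2 * h)"
    show "E \<inter> F \<in> sets lebesgue" using E F by auto
    have "(?r E \<longlongrightarrow> 1) (at_right 0)" "(?r F \<longlongrightarrow> 1) (at_right 0)"
      using assms x by (auto simp: density_open_def density_points_def has_density_def)
    from tendsto_diff[OF tendsto_add[OF this] tendsto_const[of 1]]
    show "((\<lambda>h. ?r E h + ?r F h - 1) \<longlongrightarrow> 1) (at_right 0)" by simp
    fix h :: real assume h: "h > 0"
    let ?I = "{x - h..x + h}"
    have "measure lebesgue ((E \<inter> ?I) \<union> (F \<inter> ?I)) =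
        measure lebesgue (E \<inter> ?I) + measure lebesgue (F \<inter> ?I) - measure lebesgue ((E \<inter> ?I) \<inter> (F \<inter> ?I))"
      by (rule measure_Un3) (simp_all add: lmeasurable_Int_Icc E F)
    moreover have "(E \<inter> ?I) \<inter> (F \<inter> ?I) = (E \<inter> F) \<inter> ?I" by auto
    moreover have "measure lebesgue ((E \<inter> ?I) \<union> (F \<inter> ?I)) \<le> measure lebesgue ?I"
    proof (rule measure_mono_fmeasurable)
      show "(E \<inter> ?I) \<union> (F \<inter> ?I) \<in> sets lebesgue"
        by (intro sets.Un fmeasurableD lmeasurable_Int_Icc E F)
    qed auto
    ultimately have "measure lebesgue (E \<inter> ?I) + measure lebesgue (F \<inter> ?I) - 2 * h
        \<le> measure lebesgue ((E \<inter> F) \<inter> ?I)"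
      using h by simp
    then have "(measure lebesgue (E \<inter> ?I) + measure lebesgue (F \<inter> ?I) - 2 * h) / (2 * h)
        \<le> ?r (E \<inter> F) h"
      using h by (intro divide_right_mono) auto
    then show "?r E h + ?r F h - 1 \<le> ?r (E \<inter> F) h"
      using h by (simp add: add_divide_distrib diff_divide_distrib)
  qed
  then show ?thesis
    using E F by (auto simp: density_open_def density_points_def)
qed

lemma countable_measurable_hull:
  fixes a b :: real
  assumes K: "\<And>E. E \<in> K \<Longrightarrow> E \<in> sets lebesgue"
  obtains C where "countable C" "C \<subseteq> K" "\<And>E. E \<in> K \<Longrightarrow> negligible (E \<inter> {a..b} - \<Union>C)"
proof -
  let ?I = "{a..b}"
  let ?m = "\<lambda>D. measure lebesgue (\<Union>D \<inter> ?I)"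
  let ?N = "{D. countable D \<and> D \<subseteq> K}"
  have lm: "\<Union>D \<inter> ?I \<in> lmeasurable" if "D \<in> ?N" for D
    using that K by (intro lmeasurable_Int_Icc sets.countable_Union) auto
  have "?m D \<le> measure lebesgue ?I" if "D \<in> ?N" for D
    by (rule measure_mono_fmeasurable[OF _ fmeasurableD[OF lm[OF that]]]) auto
  then have bdd: "bdd_above (?m ` ?N)" by (rule bdd_aboveI2)
  define s where "s = (SUP D\<in>?N. ?m D)"
  have le_s: "?m D \<le> s" if "D \<in> ?N" for D
    unfolding s_def by (rule cSUP_upper[OF that bdd])
  have "\<exists>D\<in>?N. s - 1 / Suc n < ?m D" for n
    using less_cSUP_iff[OF _ bdd, of "s - 1 / Suc n"] unfolding s_def[symmetric] by fastforce
  then obtain D where D: "\<And>n. D n \<in> ?N" "\<And>n. s - 1 / Suc n < ?m (D n)" by metis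
  define C where "C = (\<Union>n. D n)"
  have C: "C \<in> ?N" using D(1) by (auto simp: C_def)
  have s_le: "s \<le> ?m C"
  proof (rule field_le_epsilon)
    fix e :: real assume "e > 0"
    then obtain n where "1 / Suc n < e" using nat_approx_posE by metis
    moreover have "?m (D n) \<le> ?m C"
      by (rule measure_mono_fmeasurable) (use lm D(1) C in \<open>auto simp: C_def\<close>)
    ultimately show "s \<le> ?m C + e" using D(2)[of n] by simp
  qed
  show ?thesis
  proof (rule that[of C])
    fix E assume E: "E \<in> K"
    have iC: "insert E C \<in> ?N" using C E by auto
    have sub: "\<Union>C \<inter> ?I \<subseteq> \<Union>(insert E C) \<inter> ?I" by auto
    have eq: "E \<inter> ?I - \<Union>C = (\<Union>(insert E C) \<inter> ?I) - (\<Union>C \<inter> ?I)" by auto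
    have "measure lebesgue (E \<inter> ?I - \<Union>C) = ?m (insert E C) - ?m C"
      unfolding eq by (rule measurable_measure_Diff[OF lm[OF iC] fmeasurableD[OF lm[OF C]] sub])
    also have "\<dots> \<le> 0" using le_s[OF iC] s_le by simp
    finally have "measure lebesgue (E \<inter> ?I - \<Union>C) = 0" by (simp only: measure_le_0_iff)
    moreover have "E \<inter> ?I - \<Union>C \<in> lmeasurable"
      unfolding eq by (rule fmeasurable.Diff[OF lm[OF iC] lm[OF C]])
    ultimately show "negligible (E \<inter> ?I - \<Union>C)"
      by (simp add: negligible_iff_measure)
  qed (use C in auto)
qed

lemma density_open_Union:
  assumes K: "\<And>E. E \<in> K \<Longrightarrow> density_open E"
  shows "density_open (\<Union>K)"
proof -
  have Km: "E \<in> sets lebesgue" if "E \<in> K" for E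
    using K[OF that] by (simp add: density_open_def)
  have "\<exists>C. countable C \<and> C \<subseteq> K \<and> (\<forall>E\<in>K. negligible (E \<inter> {- real n..real n} - \<Union>C))" for n :: nat
    using countable_measurable_hull[OF Km] by metis
  then obtain D where D: "\<And>n. countable (D n)" "\<And>n. D n \<subseteq> K"
    "\<And>n E. E \<in> K \<Longrightarrow> negligible (E \<inter> {- real n..real n} - \<Union>(D n))" by metis
  define B where "B = (\<Union>n. \<Union>(D n))"
  have Bm: "B \<in> sets lebesgue"
  proof -
    have "\<Union>(D n) \<in> sets lebesgue" for n
      using D(1)[of n] D(2)[of n] Km by (intro sets.countable_Union) auto
    then show ?thesis unfolding B_def by blast
  qed
  have EB: "negligible (E - B)" if "E \<in> K" for E
  proof (rule negligible_subset)
    show "negligible (\<Union>n. E \<inter> {- real n..real n} - \<Union>(D n))"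
      by (rule negligible_countable_Union) (use D(3)[OF that] in auto)
    show "E - B \<subseteq> (\<Union>n. E \<inter> {- real n..real n} - \<Union>(D n))"
    proof
      fix y assume y: "y \<in> E - B"
      obtain n where "\<bar>y\<bar> \<le> real n" using real_arch_simple by blast
      then show "y \<in> (\<Union>n. E \<inter> {- real n..real n} - \<Union>(D n))"
        using y by (auto simp: B_def intro!: exI[of _ n])
    qed
  qed
  have "negligible (\<Union>K - B)"
    unfolding negligible_eq_zero_density
  proof (intro ballI allI impI)
    fix x r e :: real assume x: "x \<in> \<Union>K - B" and r: "r > 0" and e: "e > 0"
    from x obtain E where E: "E \<in> K" "x \<in> E" by auto
    let ?I = "\<lambda>h. {x - h..x + h}"
    let ?q = "\<lambda>h. measure lebesgue (E \<inter> ?I h) / (2 * h)"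
    have "(?q \<longlongrightarrow> 1) (at_right 0)"
      using K[OF E(1)] E(2) by (auto simp: density_open_def density_points_def has_density_def)
    then have "\<forall>\<^sub>F h in at_right 0. 1 - e < ?q h"
      using e by (auto dest!: order_tendstoD(1)[of _ _ _ "1 - e"])
    moreover have "\<forall>\<^sub>F h in at_right 0. h \<in> {0<..<r}" by (rule eventually_at_right_real[OF r])
    ultimately have "\<forall>\<^sub>F h in at_right 0. 1 - e < ?q h \<and> h \<in> {0<..<r}" by (rule eventually_conj)
    then obtain h where h: "1 - e < ?q h" "0 < h" "h < r"
      using eventually_happens'[OF trivial_limit_at_right_real] by fastforce
    let ?V = "?I h - E \<inter> ?I h"
    let ?U = "?V \<union> (E - B)"
    have Em: "E \<inter> ?I h \<in> lmeasurable" by (rule lmeasurable_Int_Icc[OF Km[OF E(1)]])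
    have Vm: "?V \<in> lmeasurable" by (intro fmeasurable.Diff Em) simp
    have mV: "measure lebesgue ?V = 2 * h - measure lebesgue (E \<inter> ?I h)"
      using measurable_measure_Diff[of "?I h" lebesgue "E \<inter> ?I h"] Em h(2) by (auto dest: fmeasurableD)
    have "measure lebesgue ?U = measure lebesgue ?V"
      by (rule measure_Un_null_set)
         (use Vm EB[OF E(1)] in \<open>auto simp: negligible_iff_null_sets dest: fmeasurableD\<close>)
    moreover have "?U \<in> lmeasurable"
      by (intro fmeasurable.Un Vm negligible_imp_measurable EB E)
    moreover have "2 * h - measure lebesgue (E \<inter> ?I h) < e * (2 * h)"
      using h by (simp add: field_simps)
    moreover have "measure lebesgue (ball x h) = 2 * h"
      using h by (simp add: ball_eq_greaterThanLessThan)
    moreover have "(\<Union>K - B) \<inter> ball x h \<subseteq> ?U"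
      by (auto simp: ball_eq_greaterThanLessThan)
    ultimately show "\<exists>d. 0 < d \<and> d \<le> r \<and>
        (\<exists>U. (\<Union>K - B) \<inter> ball x d \<subseteq> U \<and> U \<in> lmeasurable \<and>
             measure lebesgue U < e * measure lebesgue (ball x d))"
      using h(2,3) mV by (intro exI[of _ h] conjI exI[of _ ?U]) auto
  qed
  then have "\<Union>K - B \<in> sets lebesgue" by (simp add: negligible_imp_sets)
  moreover have "\<Union>K = B \<union> (\<Union>K - B)" using D(2) by (auto simp: B_def)
  ultimately have Um: "\<Union>K \<in> sets lebesgue" using Bm by (metis sets.Un)
  have "has_density (\<Union>K) 1 x" if E: "E \<in> K" and x: "x \<in> E" for x E
  proof (rule has_density_1_mono[OF Um])
    let ?r = "\<lambda>G h. measure lebesgue (G \<inter> {x - h..x + h}) / (2 * h)"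
    show "(?r E \<longlongrightarrow> 1) (at_right 0)"
      using K[OF E] x by (auto simp: density_open_def density_points_def has_density_def)
    fix h :: real assume "h > 0"
    moreover have "measure lebesgue (E \<inter> {x - h..x + h}) \<le> measure lebesgue (\<Union>K \<inter> {x - h..x + h})"
      by (rule measure_mono_fmeasurable)
         (use E lmeasurable_Int_Icc[OF Km[OF E]] lmeasurable_Int_Icc[OF Um] in auto)
    ultimately show "?r E h \<le> ?r (\<Union>K) h" by (simp add: divide_right_mono)
  qed
  then show ?thesis using Um by (auto simp: density_open_def density_points_def)
qed

lemma istopology_density_open: "istopology density_open"
  unfolding istopology_def using density_open_Int density_open_Union by blast

lemma openin_density_topology: "openin density_topology E \<longleftrightarrow> density_open E"
  by (simp add: density_topology_def topology_inverse' istopology_density_open)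

lemma density_open_UNIV: "density_open UNIV"
proof -
  have "has_density UNIV 1 x" for x
    by (rule has_density_1_mono[of UNIV "\<lambda>h. 1"]) auto
  then show ?thesis by (auto simp: density_open_def density_points_def)
qed

lemma topspace_density_topology [simp]: "topspace density_topology = UNIV"
  using openin_subset[of density_topology UNIV] density_open_UNIV
  by (auto simp: openin_density_topology)

section \<open>Orthocompactness\<close>

text \<open>Intersections of subfamilies are taken inside the space, so that the empty subfamily
  has intersection \<open>topspace X\<close>.\<close>

definition interior_preserving :: "'a topology \<Rightarrow> 'a set set \<Rightarrow> bool" where
  "interior_preserving X \<U> \<longleftrightarrow>
     (\<forall>U\<in>\<U>. openin X U) \<and> (\<forall>\<V>. \<V> \<subseteq> \<U> \<longrightarrow> openin X (topspace X \<inter> \<Inter>\<V>))"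

definition open_cover :: "'a topology \<Rightarrow> 'a set set \<Rightarrow> bool" where
  "open_cover X \<U> \<longleftrightarrow> (\<forall>U\<in>\<U>. openin X U) \<and> \<Union>\<U> = topspace X"

definition orthocompact_space :: "'a topology \<Rightarrow> bool" where
  "orthocompact_space X \<longleftrightarrow>
     (\<forall>\<U>. open_cover X \<U> \<longrightarrow>
        (\<exists>\<V>. open_cover X \<V> \<and> (\<forall>V\<in>\<V>. \<exists>U\<in>\<U>. V \<subseteq> U) \<and> interior_preserving X \<V>))"

definition hereditarily_orthocompact_space :: "'a topology \<Rightarrow> bool" where
  "hereditarily_orthocompact_space X \<longleftrightarrow>
     (\<forall>A. A \<subseteq> topspace X \<longrightarrow> orthocompact_space (subtopology X A))"

section \<open>The continuum hypothesis\<close>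

text \<open>In cardinal notation: \<open>2\<close> to the power \<open>\<aleph>\<^sub>0\<close> equals \<open>\<aleph>\<^sub>1\<close>, where \<^const>\<open>natLeq\<close> represents
  \<open>\<aleph>\<^sub>0\<close> and its cardinal successor represents \<open>\<aleph>\<^sub>1\<close>.\<close>

definition continuum_hypothesis :: bool where
  "continuum_hypothesis \<longleftrightarrow> ctwo ^c natLeq =o cardSuc natLeq"

end

theory Submission
  imports Defs
begin

text \<open>Under the continuum hypothesis a transfinite recursion of length \<open>\<omega>\<^sub>1\<close> yields a Sierpinski set \<open>S\<close>
  of size continuum: it meets every null set in a countable set and every set of positive measure.
  The second property makes it dense. Any \<open>A \<subseteq> S\<close> is orthocompact (even metacompact) for the
  following reason. Up to a null set, hence up to countably many points of \<open>A\<close>, an open cover has a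
  countable subcover. Disjointify it; by the Lebesgue density theorem the density interiors of the
  pieces still cover \<open>A\<close> except for a countable set \<open>R\<close>. Give the points of \<open>R\<close> neighbourhoods inside
  intervals of summable length: by Borel--Cantelli only a null set of points lies in infinitely many
  of them, and null sets may be removed because they are closed in the density topology. The result
  is a point-finite open refinement, and point-finite open families are interior preserving.\<close>

section \<open>The Lebesgue density theorem\<close>

lemma lmeasurable_outer_open:
  fixes T :: "real set"
  assumes T: "T \<in> lmeasurable" and e: "e > 0"
  obtains U where "open U" "T \<subseteq> U" "U \<in> lmeasurable"
    "measure lebesgue U \<le> measure lebesgue T + e"
proof -
  obtain U where U: "open U" "T \<subseteq> U" "U - T \<in> lmeasurable" "emeasure lebesgue (U - T) < ennreal e"
    using sets_lebesgue_outer_open[OF fmeasurableD[OF T] e] by blast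
  have eq: "U = T \<union> (U - T)" using U by auto
  have "measure lebesgue (U - T) < e"
    using U(3,4) e by (simp add: emeasure_eq_measure2 ennreal_less_iff)
  moreover have "measure lebesgue U \<le> measure lebesgue T + measure lebesgue (U - T)"
    by (subst eq, rule measure_Un_le) (use T U in auto)
  moreover have "U \<in> lmeasurable" by (subst eq, rule fmeasurable.Un[OF T U(3)])
  ultimately show ?thesis using that U(1,2) by force
qed

text \<open>Outer measure stands in for the measure of \<open>X\<close>, whose measurability is not known: a Vitali
  cover of \<open>X\<close> inside an open \<open>U\<close> by intervals in which \<open>E\<close> has proportion at most \<open>c\<close>
  shrinks outer covers by the factor \<open>c\<close>.\<close>

lemma negligible_if_frequently_thin:
  fixes X E :: "real set"
  assumes E: "E \<in> sets lebesgue" and XE: "X \<subseteq> E" and bX: "bounded X" and c: "0 \<le> c" "c < 1"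
    and thin: "\<And>x r. x \<in> X \<Longrightarrow> r > 0 \<Longrightarrow>
      \<exists>h. 0 < h \<and> h < r \<and> measure lebesgue (E \<inter> {x - h..x + h}) \<le> c * (2 * h)"
  shows "negligible X"
proof -
  let ?m = "measure lebesgue"
  define \<O> where "\<O> = {U. open U \<and> X \<subseteq> U \<and> U \<in> lmeasurable}"
  have step: "\<exists>V\<in>\<O>. ?m V \<le> c * ?m U + e" if U: "U \<in> \<O>" and e: "e > 0" for U e
  proof -
    have U': "open U" "X \<subseteq> U" "U \<in> lmeasurable" using U by (auto simp: \<O>_def)
    let ?B = "\<lambda>i::real \<times> real. cball (fst i) (snd i)"
    \<comment> \<open>Intervals are kept inside \<open>U\<close> so that disjoint ones have total
      measure at most that of \<open>U\<close>; summing the thinness bound then gains the factor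
      \<open>c\<close>.\<close>
    let ?K = "{(x,h). 0 < h \<and> cball x h \<subseteq> U \<and> ?m (E \<inter> cball x h) \<le> c * ?m (cball x h)}"
    have cov: "\<exists>i. i \<in> ?K \<and> x \<in> cball (fst i) (snd i) \<and> snd i < d" if "x \<in> X" "0 < d" for x d
    proof -
      obtain k where k: "k > 0" "cball x k \<subseteq> U"
        using U' \<open>x \<in> X\<close> open_contains_cball by blast
      obtain h where h: "0 < h" "h < min k d" "?m (E \<inter> {x - h..x + h}) \<le> c * (2 * h)"
        using thin[OF \<open>x \<in> X\<close>, of "min k d"] k \<open>d > 0\<close> by auto
      have "cball x h \<subseteq> U" using k h by (auto simp: cball_def)
      with h show ?thesis
        by (intro exI[of _ "(x,h)"]) (auto simp: cball_eq_atLeastAtMost)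
    qed
    obtain C where C: "countable C" "C \<subseteq> ?K"
      and pw: "pairwise (\<lambda>i j. disjnt (?B i) (?B j)) C"
      and neg: "negligible (X - (\<Union>i\<in>C. ?B i))"
    proof (rule Vitali_covering_theorem_cballs[of ?K snd X fst])
      show "0 < snd i" if "i \<in> ?K" for i using that by auto
      show "\<exists>i. i \<in> ?K \<and> x \<in> cball (fst i) (snd i) \<and> snd i < d" if "x \<in> X" "0 < d" for x d
        using that by (rule cov)
    qed
    have lm: "E \<inter> ?B i \<in> lmeasurable" for i
      using lmeasurable_Int_Icc[OF E] by (simp add: cball_eq_atLeastAtMost)
    have bd: "?m (\<Union>i\<in>I. E \<inter> ?B i) \<le> c * ?m U" if I: "I \<subseteq> C" "finite I" for I
    proof -
      have "?m (\<Union>i\<in>I. E \<inter> ?B i) \<le> (\<Sum>i\<in>I. ?m (E \<inter> ?B i))"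
        by (rule measure_UNION_le) (use I lm in \<open>auto dest: fmeasurableD\<close>)
      also have "\<dots> \<le> (\<Sum>i\<in>I. c * ?m (?B i))"
        by (rule sum_mono) (use I C in force)
      also have "\<dots> = c * ?m (\<Union>i\<in>I. ?B i)"
        by (subst measure_UNION') (use I pw in \<open>auto simp: sum_distrib_left elim: pairwise_mono\<close>)
      also have "\<dots> \<le> c * ?m U"
      proof (rule mult_left_mono[OF measure_mono_fmeasurable c(1)])
        show "(\<Union>i\<in>I. ?B i) \<subseteq> U" using I C by force
        show "(\<Union>i\<in>I. ?B i) \<in> sets lebesgue" using I by (intro sets.finite_UN) auto
      qed (use U' in auto)
      finally show ?thesis .
    qed
    let ?V = "\<Union>i\<in>C. E \<inter> ?B i"
    \<comment> \<open>The selected intervals cover \<open>X\<close> only up to a null set. Adding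
      that remainder gives a measurable set containing \<open>X\<close> without increasing the
      measure.\<close>
    let ?W = "?V \<union> (X - (\<Union>i\<in>C. ?B i))"
    have V: "?V \<in> lmeasurable" "?m ?V \<le> c * ?m U"
      using fmeasurable_UN_bound[OF C(1) lm bd] measure_UN_bound[OF C(1) lm bd] by auto
    have W: "?W \<in> lmeasurable" by (rule fmeasurable.Un[OF V(1) negligible_imp_measurable[OF neg]])
    have W_V: "?m ?W = ?m ?V"
      by (rule measure_Un_null_set)
         (use V neg in \<open>auto simp: negligible_iff_null_sets dest: fmeasurableD\<close>)
    obtain Q where Q: "open Q" "?W \<subseteq> Q" "Q \<in> lmeasurable" "?m Q \<le> ?m ?W + e"
      using lmeasurable_outer_open[OF W e] by blast
    have "X \<subseteq> ?W" using XE by auto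
    then have "Q \<in> \<O>" using Q(1-3) unfolding \<O>_def by blast
    moreover have "?m Q \<le> c * ?m U + e" using Q(4) V(2) W_V by linarith
    ultimately show ?thesis by blast
  qed
  obtain R where "X \<subseteq> ball 0 R" using bX bounded_subset_ballD by blast
  then have ne: "\<O> \<noteq> {}" by (auto simp: \<O>_def intro!: exI[of _ "ball 0 R"])
  define s where "s = (INF U\<in>\<O>. ?m U)"
  have bdd: "bdd_below (?m ` \<O>)" by (rule bdd_belowI2[of _ 0]) auto
  have s_le: "s \<le> ?m U" if "U \<in> \<O>" for U unfolding s_def by (rule cINF_lower[OF bdd that])
  have s_near: "\<exists>U\<in>\<O>. ?m U < s + e" if "e > 0" for e
    using cINF_less_iff[OF ne bdd, of "s + e"] that unfolding s_def[symmetric] by auto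
  \<comment> \<open>Apply \<open>step\<close> to a nearly optimal cover. As \<open>c < 1\<close>,
    the inequality forces the outer measure \<open>s\<close> of \<open>X\<close> to vanish.\<close>
  have "s \<le> c * s"
  proof (rule field_le_epsilon)
    fix e :: real assume e: "e > 0"
    then obtain U where U: "U \<in> \<O>" "?m U < s + e / 2" using s_near[of "e / 2"] by auto
    obtain V where "V \<in> \<O>" "?m V \<le> c * ?m U + e / 2" using step[OF U(1), of "e / 2"] e by auto
    moreover have "c * ?m U \<le> c * s + e / 2"
    proof -
      have "c * ?m U \<le> c * (s + e / 2)" using U c by (intro mult_left_mono) auto
      also have "\<dots> \<le> c * s + e / 2"
        using c e mult_right_mono[of c 1 "e/2"] by (simp add: algebra_simps)
      finally show ?thesis .
    qed
    ultimately show "s \<le> c * s + e" using s_le by fastforce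
  qed
  then have "s \<le> 0" using c(2) by (metis mult_less_cancel_right2 not_le)
  show ?thesis
    unfolding negligible_outer_le
  proof (intro allI impI)
    fix e :: real assume "e > 0"
    then obtain U where "U \<in> \<O>" "?m U < s + e" using s_near by blast
    then show "\<exists>T. X \<subseteq> T \<and> T \<in> lmeasurable \<and> ?m T \<le> e"
      using \<open>s \<le> 0\<close> by (intro exI[of _ U]) (auto simp: \<O>_def)
  qed
qed

text \<open>The ratio never exceeds 1, so at a point of \<open>E\<close> without density 1 it is,
  for some \<open>k\<close>, at most \<open>c k\<close> at arbitrarily small radii. For fixed
  \<open>k\<close>, such points in a bounded interval form a thin set, and countably many of these
  sets exhaust the exceptional points.\<close>

lemma Lebesgue_density_theorem:
  assumes E: "E \<in> sets lebesgue"
  shows "negligible (E - density_points E)"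
proof -
  let ?q = "\<lambda>x h. measure lebesgue (E \<inter> {x - h..x + h}) / (2 * h)"
  define c :: "nat \<Rightarrow> real" where "c k = 1 - 1 / Suc k" for k
  define X where "X k n = {x \<in> E \<inter> cball 0 (real n). \<forall>r>0. \<exists>h. 0 < h \<and> h < r \<and> ?q x h \<le> c k}"
    for k n
  have "negligible (X k n)" for k n
  proof (rule negligible_if_frequently_thin[OF E])
    show "bounded (X k n)" by (rule bounded_subset[of "cball 0 (real n)"]) (auto simp: X_def)
    fix x r :: real assume "x \<in> X k n" "r > 0"
    then obtain h where "0 < h" "h < r" "?q x h \<le> c k" by (auto simp: X_def)
    then show "\<exists>h. 0 < h \<and> h < r \<and> measure lebesgue (E \<inter> {x - h..x + h}) \<le> c k * (2 * h)"
      by (auto simp: field_simps intro!: exI[of _ h])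
  qed (auto simp: X_def c_def)
  then have "negligible (\<Union>k. \<Union>n. X k n)" by (intro negligible_countable_Union) auto
  moreover have "E - density_points E \<subseteq> (\<Union>k. \<Union>n. X k n)"
  proof
    fix x assume x: "x \<in> E - density_points E"
    have "\<exists>k. \<forall>r>0. \<exists>h. 0 < h \<and> h < r \<and> ?q x h \<le> c k"
    proof (rule ccontr)
      assume "\<not> ?thesis"
      then have *: "\<exists>r>0. \<forall>h. 0 < h \<and> h < r \<longrightarrow> c k < ?q x h" for k by (meson not_le)
      have "(?q x \<longlongrightarrow> 1) (at_right 0)"
      proof (rule order_tendstoI)
        fix a :: real assume "a < 1"
        then obtain k where k: "1 / Suc k < 1 - a" using nat_approx_posE[of "1 - a"] by auto
        obtain r where "r > 0" "\<forall>h. 0 < h \<and> h < r \<longrightarrow> c k < ?q x h" using * by blast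
        then show "\<forall>\<^sub>F h in at_right 0. a < ?q x h"
          unfolding eventually_at_right_field using k by (force simp: c_def)
      next
        fix a :: real assume "1 < a"
        have "?q x h \<le> 1" if "h > 0" for h
        proof -
          have "measure lebesgue (E \<inter> {x - h..x + h}) \<le> measure lebesgue {x - h..x + h}"
            by (rule measure_mono_fmeasurable) (use lmeasurable_Int_Icc[OF E] in auto)
          then show ?thesis using that by (simp add: field_simps)
        qed
        then show "\<forall>\<^sub>F h in at_right 0. ?q x h < a"
          unfolding eventually_at_right_field using \<open>1 < a\<close> by (intro exI[of _ 1]) (blast intro: le_less_trans zero_less_one)
      qed
      then show False using x by (auto simp: density_points_def has_density_def)
    qed
    moreover obtain n where "\<bar>x\<bar> \<le> real n" using real_arch_simple by blast
    ultimately show "x \<in> (\<Union>k. \<Union>n. X k n)" using x by (auto simp: X_def)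
  qed
  ultimately show ?thesis by (rule negligible_subset)
qed

section \<open>Density open sets\<close>

lemma has_density_Diff_negligible:
  assumes E: "E \<in> sets lebesgue" and N: "negligible N"
  shows "has_density (E - N) d x \<longleftrightarrow> has_density E d x"
proof -
  have "measure lebesgue ((E - N) \<inter> {x - h..x + h}) = measure lebesgue (E \<inter> {x - h..x + h})" for h
  proof -
    have "measure lebesgue (E \<inter> {x - h..x + h} - N) = measure lebesgue (E \<inter> {x - h..x + h})"
      by (rule measure_Diff_null_set)
         (use N lmeasurable_Int_Icc[OF E] in \<open>auto simp: negligible_iff_null_sets dest: fmeasurableD\<close>)
    moreover have "(E - N) \<inter> {x - h..x + h} = E \<inter> {x - h..x + h} - N" by auto
    ultimately show ?thesis by simp
  qed
  then show ?thesis by (simp add: has_density_def)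
qed

lemma density_open_Diff_negligible:
  assumes E: "density_open E" and N: "negligible N"
  shows "density_open (E - N)"
  using assms has_density_Diff_negligible[OF _ N, of E]
  by (auto simp: density_open_def density_points_def negligible_imp_sets)

text \<open>By the density theorem the intersection differs from \<open>E\<close> by a null set, so
  both have the same density points.\<close>

lemma density_open_Int_density_points:
  assumes E: "E \<in> sets lebesgue"
  shows "density_open (E \<inter> density_points E)"
proof -
  let ?N = "E - density_points E"
  have N: "negligible ?N" by (rule Lebesgue_density_theorem[OF E])
  have eq: "E \<inter> density_points E = E - ?N" by auto
  show ?thesis
    unfolding density_open_def
  proof
    show "E \<inter> density_points E \<in> sets lebesgue"
      unfolding eq using E negligible_imp_sets[OF N] by auto
    show "E \<inter> density_points E \<subseteq> density_points (E \<inter> density_points E)"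
      unfolding eq using has_density_Diff_negligible[OF E N] by (auto simp: density_points_def)
  qed
qed

text \<open>Deleting the null set \<open>E\<close> from itself changes no density, yet the empty set
  has density 0 everywhere. Hence a nonempty density open set is never null.\<close>

lemma density_open_negligible_empty:
  assumes E: "density_open E" and N: "negligible E"
  shows "E = {}"
proof (rule ccontr)
  assume "E \<noteq> {}"
  then obtain x where "x \<in> E" by auto
  then have "has_density (E - E) 1 x"
    using E has_density_Diff_negligible[OF _ N, of E]
    by (auto simp: density_open_def density_points_def)
  then show False by (simp add: has_density_def tendsto_const_iff)
qed

lemma open_imp_density_open:
  assumes "open U"
  shows "density_open U"
proof -
  have "has_density U 1 x" if x: "x \<in> U" for x
    unfolding has_density_def
  proof (rule Lim_transform_eventually[OF tendsto_const])
    obtain r where r: "r > 0" "cball x r \<subseteq> U" using assms x open_contains_cball by blast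
    have "\<forall>\<^sub>F h in at_right 0. h \<in> {0<..<r}" by (rule eventually_at_right_real[OF r(1)])
    then show "\<forall>\<^sub>F h in at_right 0. 1 = measure lebesgue (U \<inter> {x - h..x + h}) / (2 * h)"
    proof eventually_elim
      case (elim h)
      then have "{x - h..x + h} \<subseteq> U" using r(2) by (auto simp: cball_eq_atLeastAtMost)
      then have "U \<inter> {x - h..x + h} = {x - h..x + h}" by auto
      then show ?case using elim by simp
    qed
  qed
  then show ?thesis using assms by (auto simp: density_open_def density_points_def)
qed

text \<open>Countable hulls on the intervals [-n,n] make each single \<open>E - \<Union>C\<close>
  null, but \<open>K\<close> may be uncountable. The density interior of the remainder
  \<open>M\<close> meets each \<open>E\<close> in a density open null set, hence not at all. So
  \<open>M\<close> contains none of its own density points and is null by the density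
  theorem.\<close>

lemma density_open_Lindelof_mod_negligible:
  assumes K: "\<And>E. E \<in> K \<Longrightarrow> density_open E"
  obtains C where "countable C" "C \<subseteq> K" "negligible (\<Union>K - \<Union>C)"
proof -
  have Km: "E \<in> sets lebesgue" if "E \<in> K" for E
    using K[OF that] by (simp add: density_open_def)
  have "\<exists>C. countable C \<and> C \<subseteq> K \<and> (\<forall>E\<in>K. negligible (E \<inter> {- real n..real n} - \<Union>C))" for n :: nat
    using countable_measurable_hull[OF Km] by metis
  then obtain D where D: "\<And>n. countable (D n)" "\<And>n. D n \<subseteq> K"
    "\<And>n E. E \<in> K \<Longrightarrow> negligible (E \<inter> {- real n..real n} - \<Union>(D n))" by metis
  define C where "C = (\<Union>n. D n)"
  have C: "countable C" "C \<subseteq> K" using D by (auto simp: C_def)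
  define M where "M = \<Union>K - \<Union>C"
  have "\<Union>K \<in> sets lebesgue" using density_open_Union[OF K] by (simp add: density_open_def)
  moreover have "\<Union>C \<in> sets lebesgue" using C Km by (intro sets.countable_Union) auto
  ultimately have M: "M \<in> sets lebesgue" by (auto simp: M_def)
  have "(M \<inter> density_points M) \<inter> E = {}" if E: "E \<in> K" for E
  proof (rule density_open_negligible_empty)
    show "density_open ((M \<inter> density_points M) \<inter> E)"
      by (intro density_open_Int density_open_Int_density_points M K E)
    have "negligible (\<Union>n. E \<inter> {- real n..real n} - \<Union>(D n))"
      by (rule negligible_countable_Union) (use D(3)[OF E] in auto)
    moreover have "(M \<inter> density_points M) \<inter> E \<subseteq> (\<Union>n. E \<inter> {- real n..real n} - \<Union>(D n))"
    proof
      fix y assume y: "y \<in> (M \<inter> density_points M) \<inter> E"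
      obtain n where "\<bar>y\<bar> \<le> real n" using real_arch_simple by blast
      then show "y \<in> (\<Union>n. E \<inter> {- real n..real n} - \<Union>(D n))"
        using y by (auto simp: M_def C_def intro!: exI[of _ n])
    qed
    ultimately show "negligible ((M \<inter> density_points M) \<inter> E)" by (rule negligible_subset)
  qed
  then have "M - density_points M = M" by (auto simp: M_def)
  then have "negligible M" using Lebesgue_density_theorem[OF M] by simp
  then show ?thesis using that C by (simp add: M_def)
qed

section \<open>Point-finite refinements\<close>

text \<open>Finite subfamilies have open intersections; an infinite one has no common point, so its
  intersection is empty.\<close>

lemma point_finite_imp_interior_preserving:
  assumes op: "\<And>V. V \<in> \<V> \<Longrightarrow> openin X V"
    and fin: "\<And>x. x \<in> topspace X \<Longrightarrow> finite {V \<in> \<V>. x \<in> V}"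
  shows "interior_preserving X \<V>"
  unfolding interior_preserving_def
proof (intro conjI ballI allI impI)
  show "openin X V" if "V \<in> \<V>" for V using that by (rule op)
  fix \<W> assume W: "\<W> \<subseteq> \<V>"
  show "openin X (topspace X \<inter> \<Inter>\<W>)"
  proof (cases "finite \<W>")
    case True
    then show ?thesis by (rule openin_Int_Inter) (use W op in auto)
  next
    case False
    have "x \<notin> \<Inter>\<W>" if "x \<in> topspace X" for x
    proof
      assume "x \<in> \<Inter>\<W>"
      then have "\<W> \<subseteq> {V \<in> \<V>. x \<in> V}" using W by auto
      then show False using fin[OF that] False finite_subset by blast
    qed
    then have "topspace X \<inter> \<Inter>\<W> = {}" by blast
    then show ?thesis by (metis openin_empty)
  qed
qed

lemma countable_imp_negligible: "countable R \<Longrightarrow> negligible R" for R :: "real set"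
  by (simp add: negligible_iff_null_sets null_sets_completionI countable_imp_null_set_lborel)

lemma countable_radii_almost_point_finite:
  fixes R :: "real set"
  assumes R: "countable R"
  obtains \<epsilon> where "\<And>c. \<epsilon> c > 0" "negligible {x. infinite {c \<in> R. x \<in> ball c (\<epsilon> c)}}"
proof
  \<comment> \<open>For finite \<open>R\<close>, surplus indices give balls around a default point.
    They can only enlarge \<open>limsup A\<close>, and the measure of \<open>A n\<close> does not
    depend on its centre.\<close>
  define A where "A n = ball (from_nat_into R n) ((1/2) ^ n)" for n
  let ?\<epsilon> = "\<lambda>c. (1/2) ^ to_nat_on R c :: real"
  show "?\<epsilon> c > 0" for c by simp
  have m: "emeasure lebesgue (A n) < \<infinity>" "measure lebesgue (A n) = 2 * (1/2) ^ n" for n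
    unfolding A_def by (simp_all add: ball_eq_greaterThanLessThan)
  have "limsup A \<in> null_sets lebesgue"
  proof (rule borel_cantelli_limsup1)
    show "summable (\<lambda>n. measure lebesgue (A n))"
      unfolding m by (intro summable_mult summable_geometric) simp
    show "A n \<in> sets lebesgue" for n by (simp add: A_def)
  qed (rule m)
  then have "negligible (limsup A)" by (simp add: negligible_iff_null_sets)
  moreover have "{x. infinite {c \<in> R. x \<in> ball c (?\<epsilon> c)}} \<subseteq> limsup A"
  proof (rule subsetI, rule ccontr)
    fix x assume inf: "x \<in> {x. infinite {c \<in> R. x \<in> ball c (?\<epsilon> c)}}" and "x \<notin> limsup A"
    then have "finite {n. x \<in> A n}"
      unfolding mem_limsup_iff
      by (simp add: frequently_cofinite flip: cofinite_eq_sequentially)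
    moreover have "to_nat_on R ` {c \<in> R. x \<in> ball c (?\<epsilon> c)} \<subseteq> {n. x \<in> A n}"
      using R by (auto simp: A_def)
    ultimately have "finite (to_nat_on R ` {c \<in> R. x \<in> ball c (?\<epsilon> c)})" using finite_subset by blast
    moreover have "inj_on (to_nat_on R) {c \<in> R. x \<in> ball c (?\<epsilon> c)}"
      by (rule inj_on_subset[OF inj_on_to_nat_on[OF R]]) blast
    ultimately show False using inf by (simp add: finite_image_iff)
  qed
  ultimately show "negligible {x. infinite {c \<in> R. x \<in> ball c (?\<epsilon> c)}}" by (rule negligible_subset)
qed

lemma orthocompact_if_countable_null_traces:
  assumes A: "\<And>N. negligible N \<Longrightarrow> countable (A \<inter> N)"
  shows "orthocompact_space (subtopology density_topology A)"
  unfolding orthocompact_space_def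
proof (intro allI impI)
  let ?X = "subtopology density_topology A"
  have opI: "openin ?X (G \<inter> A)" if "density_open G" for G
    using that by (auto simp: openin_subtopology openin_density_topology)
  fix \<U> assume cov: "open_cover ?X \<U>"
  \<comment> \<open>\<open>A\<close> may be non-measurable, so measure arguments run on density open
    subsets of the line; traces on \<open>A\<close> are taken when the refinement is formed.\<close>
  define K where "K = {G. density_open G \<and> G \<inter> A \<in> \<U>}"
  have K: "density_open G" if "G \<in> K" for G using that by (simp add: K_def)
  have KU: "G \<inter> A \<in> \<U>" if "G \<in> K" for G using that by (simp add: K_def)
  have AK: "A \<subseteq> \<Union>K"
  proof
    fix x assume "x \<in> A"
    then obtain U where "U \<in> \<U>" "x \<in> U" using cov by (auto simp: open_cover_def)
    moreover have "openin ?X U" using cov \<open>U \<in> \<U>\<close> by (auto simp: open_cover_def)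
    ultimately show "x \<in> \<Union>K" 
      by (auto simp: openin_subtopology openin_density_topology K_def)
  qed
  obtain C where C: "countable C" "C \<subseteq> K" "negligible (\<Union>K - \<Union>C)"
    using density_open_Lindelof_mod_negligible[OF K] by blast
  let ?i = "to_nat_on C"
  have inj: "inj_on ?i C" using C(1) by auto
  \<comment> \<open>\<open>D U\<close> keeps the points whose first member of \<open>C\<close> is
    \<open>U\<close>. The pieces are disjoint and measurable but perhaps not open, so
    \<open>Q U\<close> passes to the density interior.\<close>
  define D where "D U = U - \<Union>{V \<in> C. ?i V < ?i U}" for U
  define Q where "Q U = D U \<inter> density_points (D U)" for U
  have D: "D U \<in> sets lebesgue" if "U \<in> C" for U
  proof -
    have m: "V \<in> sets lebesgue" if "V \<in> C" for V
      using that C(2) K by (auto simp: density_open_def)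
    have "\<Union>{V \<in> C. ?i V < ?i U} \<in> sets lebesgue"
      by (rule sets.countable_Union) (use m C(1) in \<open>auto intro: countable_subset\<close>)
    then show ?thesis using m[OF that] by (auto simp: D_def)
  qed
  have Q_open: "density_open (Q U)" if "U \<in> C" for U
    unfolding Q_def by (rule density_open_Int_density_points[OF D[OF that]])
  have Q_disj: "U = V" if "U \<in> C" "V \<in> C" "x \<in> Q U" "x \<in> Q V" for U V x
  proof -
    have "?i U = ?i V" using that by (auto simp: Q_def D_def not_less intro: antisym)
    then show ?thesis using inj that by (auto dest: inj_onD)
  qed
  have UnD: "\<Union>C \<subseteq> (\<Union>U\<in>C. D U)"
  proof
    fix x assume "x \<in> \<Union>C"
    then obtain U where "U \<in> C" "x \<in> U" "\<And>V. V \<in> C \<Longrightarrow> x \<in> V \<Longrightarrow> ?i U \<le> ?i V"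
      using ex_has_least_nat[of "\<lambda>U. U \<in> C \<and> x \<in> U" _ ?i] by blast
    then show "x \<in> (\<Union>U\<in>C. D U)" by (force simp: D_def)
  qed
  define R where "R = A - (\<Union>U\<in>C. Q U)"
  have R: "countable R"
  proof -
    have "negligible ((\<Union>K - \<Union>C) \<union> (\<Union>U\<in>C. D U - density_points (D U)))"
      by (intro negligible_Un C(3) negligible_countable_Union)
         (use C(1) Lebesgue_density_theorem[OF D] in auto)
    \<comment> \<open>A point of \<open>R\<close> is either missed by \<open>C\<close> or lies in
      some \<open>D U\<close> without being a density point of it.\<close>
    moreover have "R \<subseteq> A \<inter> ((\<Union>K - \<Union>C) \<union> (\<Union>U\<in>C. D U - density_points (D U)))"
    proof
      fix x assume x: "x \<in> R"
      then have "x \<in> A" "x \<in> \<Union>K" using AK by (auto simp: R_def)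
      moreover have "x \<in> D U - density_points (D U)" if "U \<in> C" "x \<in> D U" for U
        using x that by (auto simp: R_def Q_def)
      ultimately show "x \<in> A \<inter> ((\<Union>K - \<Union>C) \<union> (\<Union>U\<in>C. D U - density_points (D U)))"
        using UnD by blast
    qed
    ultimately show ?thesis using A countable_subset by blast
  qed
  obtain \<epsilon> where \<epsilon>: "\<And>c. \<epsilon> c > 0" "negligible {x. infinite {c \<in> R. x \<in> ball c (\<epsilon> c)}}"
    using countable_radii_almost_point_finite[OF R] by blast
  \<comment> \<open>Including \<open>R\<close> in \<open>Z\<close> ensures that a point of
    \<open>R\<close> lies in no \<open>N c\<close> but possibly its own; outside \<open>Z\<close>
    only finitely many balls contain a given point.\<close>
  define Z where "Z = {x. infinite {c \<in> R. x \<in> ball c (\<epsilon> c)}} \<union> R"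
  have Z: "negligible Z" unfolding Z_def by (rule negligible_Un[OF \<epsilon>(2) countable_imp_negligible[OF R]])
  have "\<exists>G\<in>K. c \<in> G" if "c \<in> R" for c using AK that by (auto simp: R_def)
  then obtain g where g: "\<And>c. c \<in> R \<Longrightarrow> g c \<in> K \<and> c \<in> g c" by metis
  \<comment> \<open>The centre is spared from the deletion so that \<open>N c\<close> remains a
    neighbourhood of \<open>c\<close>.\<close>
  define N where "N c = (g c \<inter> ball c (\<epsilon> c)) - (Z - {c})" for c
  have N_open: "density_open (N c)" if "c \<in> R" for c
    unfolding N_def
  proof (intro density_open_Diff_negligible density_open_Int)
    show "density_open (g c)" using g[OF that] K by blast
    show "density_open (ball c (\<epsilon> c))" by (rule open_imp_density_open) simp
    show "negligible (Z - {c})" using Z by (rule negligible_subset) blast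
  qed
  have N_fin: "finite {c \<in> R. x \<in> N c}" for x
  proof (cases "x \<in> Z")
    case True
    then have "{c \<in> R. x \<in> N c} \<subseteq> {x}" by (auto simp: N_def)
    then show ?thesis using finite_subset by blast
  next
    case False
    then have "finite {c \<in> R. x \<in> ball c (\<epsilon> c)}" by (simp add: Z_def)
    then show ?thesis by (rule rev_finite_subset) (auto simp: N_def)
  qed
  let ?\<V> = "(\<lambda>U. Q U \<inter> A) ` C \<union> (\<lambda>c. N c \<inter> A) ` R"
  show "\<exists>\<V>. open_cover ?X \<V> \<and> (\<forall>V\<in>\<V>. \<exists>U\<in>\<U>. V \<subseteq> U) \<and> interior_preserving ?X \<V>"
  proof (intro exI conjI)
    have op: "openin ?X V" if "V \<in> ?\<V>" for V using that opI Q_open N_open by blast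
    have "c \<in> N c" if "c \<in> R" for c using g[OF that] \<epsilon>(1) by (auto simp: N_def)
    then have "\<Union>?\<V> = A" by (auto simp: R_def)
    then show "open_cover ?X ?\<V>" using op by (auto simp: open_cover_def)
    show "\<forall>V\<in>?\<V>. \<exists>U\<in>\<U>. V \<subseteq> U"
    proof
      fix V assume "V \<in> ?\<V>"
      then have "\<exists>G\<in>K. V \<subseteq> G \<inter> A" using C(2) g by (fastforce simp: Q_def D_def N_def)
      then show "\<exists>U\<in>\<U>. V \<subseteq> U" using KU by blast
    qed
    show "interior_preserving ?X ?\<V>"
    proof (rule point_finite_imp_interior_preserving[OF op])
      fix x
      have "finite {U \<in> C. x \<in> Q U}"
      proof (cases "\<exists>V\<in>C. x \<in> Q V")
        case True
        then obtain V where "V \<in> C" "x \<in> Q V" by blast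
        then have "{U \<in> C. x \<in> Q U} \<subseteq> {V}" using Q_disj by auto
        then show ?thesis using finite_subset by blast
      next
        case False
        then have "{U \<in> C. x \<in> Q U} = {}" by auto
        then show ?thesis by (metis finite.emptyI)
      qed
      then have "finite ((\<lambda>U. Q U \<inter> A) ` {U \<in> C. x \<in> Q U} \<union> (\<lambda>c. N c \<inter> A) ` {c \<in> R. x \<in> N c})"
        using N_fin by blast
      then show "finite {V \<in> ?\<V>. x \<in> V}" by (rule rev_finite_subset) auto
    qed
  qed
qed

section \<open>Sierpinski sets\<close>

text \<open>With a countable basis, a sequence of open sets is coded by a set of pairs of naturals,
  hence by a set of naturals, and these are equipollent with the reals. One real parameter can thus
  list both the null sets to avoid and the closed sets to hit.\<close>

lemma open_sequences_real_parametrization: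
  obtains G :: "real \<Rightarrow> nat \<Rightarrow> real set"
  where "\<And>a n. open (G a n)" "\<And>F. (\<And>n. open (F n)) \<Longrightarrow> \<exists>a. G a = F"
proof -
  obtain B :: "nat \<Rightarrow> real set" where B: "topological_basis (range B)"
  proof -
    obtain \<B> :: "real set set" where "countable \<B>" "topological_basis \<B>" using ex_countable_basis by blast
    moreover have "\<B> \<noteq> {}"
    proof
      assume "\<B> = {}"
      then show False using topological_basisE[OF \<open>topological_basis \<B>\<close>, of UNIV 0] by auto
    qed
    ultimately show ?thesis using that by (metis range_from_nat_into)
  qed
  obtain h :: "real \<Rightarrow> nat set" where h: "bij_betw h UNIV UNIV"
    using nat_sets_eqpoll_reals eqpoll_sym unfolding eqpoll_def by blast
  define G where "G a n = \<Union>(B ` {i. prod_encode (n, i) \<in> h a})" for a n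
  show ?thesis
  proof
    show "open (G a n)" for a n
      unfolding G_def by (intro open_UN ballI topological_basis_open[OF B] rangeI)
    fix F :: "nat \<Rightarrow> real set" assume F: "\<And>n. open (F n)"
    have "\<exists>I. F n = \<Union>(B ` I)" for n
      using F[of n] B unfolding topological_basis_def by (metis subset_imageE)
    then obtain I where I: "\<And>n. F n = \<Union>(B ` I n)" by metis
    let ?J = "{p. snd (prod_decode p) \<in> I (fst (prod_decode p))}"
    have "h (inv h ?J) = ?J" by (rule surj_f_inv_f[OF bij_betw_imp_surj[OF h]])
    then have "G (inv h ?J) n = F n" for n by (simp add: G_def I)
    then have "G (inv h ?J) = F" by (rule ext)
    then show "\<exists>a. G a = F" by blast
  qed
qed

text \<open>Up to a null set, \<open>E\<close> is a countable union of closed sets, one of which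
  must be non-null. It therefore suffices to hit the non-null closed sets, which are listed by the
  reals.\<close>

lemma nonnegligible_contains_closed:
  assumes E: "E \<in> sets lebesgue" "\<not> negligible E"
  obtains T where "closed T" "T \<subseteq> E" "\<not> negligible T"
proof -
  obtain C T where CT: "fsigma C" "T \<in> null_sets lebesgue" "C \<union> T = E"
    using lebesgue_set_almost_fsigma[OF E(1)] by metis
  obtain F where F: "\<And>n::nat. closed (F n)" "C = \<Union>(range F)"
    using CT(1) by (auto elim: fsigma.cases)
  have "\<not> negligible C" using CT E(2) negligible_Un by (auto simp: negligible_iff_null_sets)
  then obtain n where "\<not> negligible (F n)" 
    unfolding F(2) using negligible_countable_Union[of "range F"] by auto
  then show ?thesis using that[of "F n"] F CT(3) by auto
qed

lemma negligible_subset_null_gdelta: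
  fixes N :: "real set"
  assumes N: "negligible N"
  obtains F where "\<And>n::nat. open (F n)" "N \<subseteq> \<Inter>(range F)" "negligible (\<Inter>(range F))"
proof -
  obtain C T where CT: "gdelta C" "T \<in> null_sets lebesgue" "N \<union> T = C"
    using lebesgue_set_almost_gdelta[OF negligible_imp_sets[OF N]] by metis
  obtain F where F: "\<And>n::nat. open (F n)" "C = \<Inter>(range F)"
    using CT(1) by (auto elim: gdelta.cases)
  have "negligible C" using CT N by (auto simp: negligible_iff_null_sets)
  then show ?thesis using that F CT(3) by blast
qed

lemma continuum_eq_reals: "|UNIV :: real set| =o ctwo ^c natLeq"
proof -
  have "|UNIV :: real set| =o |UNIV :: nat set set|"
    using nat_sets_eqpoll_reals eqpoll_sym eqpoll_iff_card_of_ordIso by blast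
  also have "|UNIV :: nat set set| =o ctwo ^c natLeq"
    using card_of_Pow_Func[of "UNIV :: nat set"]
    by (simp add: cexp_def ctwo_def Field_natLeq Field_card_of)
  finally show ?thesis .
qed

lemma CH_Sierpinski_set:
  assumes CH: "continuum_hypothesis"
  obtains S :: "real set" where "|S| =o |UNIV :: real set|"
    "\<And>N. negligible N \<Longrightarrow> countable (S \<inter> N)"
    "\<And>E. E \<in> sets lebesgue \<Longrightarrow> \<not> negligible E \<Longrightarrow> S \<inter> E \<noteq> {}"
proof -
  obtain G :: "real \<Rightarrow> nat \<Rightarrow> real set" where Gop: "\<And>a n. open (G a n)"
    and Gsurj: "\<And>F. (\<And>n. open (F n)) \<Longrightarrow> \<exists>a. G a = F"
    using open_sequences_real_parametrization by blast
  \<comment> \<open>The default values keep every \<open>M a\<close> null and every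
    \<open>P a\<close> non-null, so no stage of the recursion needs a case distinction.
    \<open>P\<close> reads only entry 0 of the sequence.\<close>
  define M where "M a = (if negligible (\<Inter>(range (G a))) then \<Inter>(range (G a)) else {})" for a
  define P where "P a = (if negligible (- G a 0) then UNIV else - G a 0)" for a
  have M: "negligible (M a)" for a by (simp add: M_def)
  have P: "\<not> negligible (P a)" for a
    using non_negligible_UNIV by (simp add: P_def)
  let ?r = "|UNIV :: real set|"
  have Fr: "Field ?r = UNIV" by (rule Field_card_of)
  have wo: "Well_order ?r" by (rule card_of_Well_order)
  have "?r =o cardSuc natLeq"
    using ordIso_transitive[OF continuum_eq_reals] CH by (simp add: continuum_hypothesis_def)
  \<comment> \<open>The continuum hypothesis enters here: a proper initial segment of the cardinal
    order has size below the successor of aleph-0, so it is countable.\<close>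
  have seg: "countable (underS ?r a)" for a
  proof -
    have "|underS ?r a| <o ?r" by (rule card_of_underS[OF card_of_Card_order]) (simp add: Fr)
    then have "|underS ?r a| <o cardSuc natLeq"
      using \<open>?r =o cardSuc natLeq\<close> by (rule ordLess_ordIso_trans)
    then have "|underS ?r a| \<le>o natLeq"
      by (simp add: cardSuc_ordLeq_ordLess natLeq_Card_order card_of_Card_order)
    then have "|underS ?r a| \<le>o |UNIV :: nat set|"
      using ordIso_symmetric[OF card_of_nat] by (rule ordLeq_ordIso_trans)
    then show ?thesis unfolding card_of_ordLeq[symmetric] by (auto simp: countable_def)
  qed
  have wf: "wf (?r - Id)" using wo by (simp add: well_order_on_def)
  have mem: "(z, a) \<in> ?r - Id \<longleftrightarrow> z \<in> underS ?r a" for z a by (auto simp: underS_def)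
  \<comment> \<open>Stage \<open>a\<close> hits \<open>P a\<close>, avoids all null sets listed up
    to and including \<open>a\<close>, and avoids earlier values to make \<open>f\<close> injective.
    Countability of the segment makes the forbidden set null, so it cannot exhaust
    \<open>P a\<close>.\<close>
  have "\<exists>f. \<forall>a. f a \<in> P a - ((\<Union>b\<in>insert a (underS ?r a). M b) \<union> f ` underS ?r a)"
  proof (rule dependent_wf_choice[OF wf])
    show "(y \<in> P a - ((\<Union>b\<in>insert a (underS ?r a). M b) \<union> f ` underS ?r a)) =
        (y \<in> P a - ((\<Union>b\<in>insert a (underS ?r a). M b) \<union> g ` underS ?r a))"
      if "\<And>z. (z, a) \<in> ?r - Id \<Longrightarrow> f z = g z" for f g a y
    proof -
      have "f ` underS ?r a = g ` underS ?r a" using that unfolding mem by (rule image_cong[OF refl])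
      then show ?thesis by simp
    qed
    show "\<exists>y. y \<in> P a - ((\<Union>b\<in>insert a (underS ?r a). M b) \<union> f ` underS ?r a)" for a f
    proof (rule ccontr)
      assume "\<not> ?thesis"
      then have "P a \<subseteq> (\<Union>b\<in>insert a (underS ?r a). M b) \<union> f ` underS ?r a" by blast
      moreover have "negligible ((\<Union>b\<in>insert a (underS ?r a). M b) \<union> f ` underS ?r a)"
      proof (rule negligible_Un)
        show "negligible (\<Union>b\<in>insert a (underS ?r a). M b)"
          by (rule negligible_countable_Union) (use seg M in auto)
        show "negligible (f ` underS ?r a)" by (intro countable_imp_negligible countable_image seg)
      qed
      ultimately show False using P negligible_subset by blast
    qed
  qed
  then obtain f where f: "\<And>a. f a \<in> P a"
    "\<And>a b. b \<in> insert a (underS ?r a) \<Longrightarrow> f a \<notin> M b"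
    "\<And>a b. b \<in> underS ?r a \<Longrightarrow> f a \<noteq> f b"
    by (metis (no_types, lifting) DiffD1 DiffD2 UN_I UnI1 UnI2 imageI)
  have tot: "a = b \<or> a \<in> underS ?r b \<or> b \<in> underS ?r a" for a b
    using wo Fr unfolding well_order_on_def linear_order_on_def total_on_def underS_def by auto
  have "inj f" using tot f(3) by (metis injI)
  show ?thesis
  proof
    show "|range f| =o ?r" using \<open>inj f\<close> card_of_ordIsoI inj_on_imp_bij_betw ordIso_symmetric by metis
    fix N :: "real set" assume "negligible N"
    then obtain F where F: "\<And>n::nat. open (F n)" "N \<subseteq> \<Inter>(range F)" "negligible (\<Inter>(range F))"
      using negligible_subset_null_gdelta by blast
    obtain a where "G a = F" using Gsurj F(1) by blast
    then have "N \<subseteq> M a" using F by (simp add: M_def)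
    \<comment> \<open>From stage \<open>a\<close> on, all values avoid \<open>M a\<close>; only the
      countably many earlier values can lie in \<open>N\<close>.\<close>
    have "range f \<inter> N \<subseteq> f ` underS ?r a"
      using \<open>N \<subseteq> M a\<close> f(2) tot by blast
    then show "countable (range f \<inter> N)" using countable_image[OF seg] by (rule countable_subset)
  next
    fix E :: "real set" assume "E \<in> sets lebesgue" "\<not> negligible E"
    then obtain T where T: "closed T" "T \<subseteq> E" "\<not> negligible T"
      using nonnegligible_contains_closed by blast
    obtain a where "G a = (\<lambda>n. - T)" using Gsurj[of "\<lambda>n. - T"] T(1) by auto
    then have "P a = T" using T(3) by (simp add: P_def)
    then show "range f \<inter> E \<noteq> {}" using f(1) T(2) by blast
  qed
qed

theorem theorem4p2:
  assumes "continuum_hypothesis"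
  shows "\<exists>S :: real set. |S| =o ctwo ^c natLeq
           \<and> density_topology closure_of S = topspace density_topology
           \<and> hereditarily_orthocompact_space (subtopology density_topology S)"
proof -
  obtain S :: "real set" where S: "|S| =o |UNIV :: real set|"
    "\<And>N. negligible N \<Longrightarrow> countable (S \<inter> N)"
    "\<And>E. E \<in> sets lebesgue \<Longrightarrow> \<not> negligible E \<Longrightarrow> S \<inter> E \<noteq> {}"
    using CH_Sierpinski_set[OF assms] by blast
  have "|S| =o ctwo ^c natLeq" using S(1) continuum_eq_reals by (rule ordIso_transitive)
  moreover have "x \<in> density_topology closure_of S" for x
    unfolding in_closure_of openin_density_topology
  proof (intro conjI allI impI)
    fix T assume T: "x \<in> T \<and> density_open T"
    then have "\<not> negligible T" using density_open_negligible_empty by blast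
    then show "\<exists>y. y \<in> S \<and> y \<in> T" using S(3)[of T] T by (auto simp: density_open_def)
  qed simp
  \<comment> \<open>Countability of traces on null sets passes from \<open>S\<close> to its subsets,
    which gives heredity.\<close>
  moreover have "orthocompact_space (subtopology density_topology A)" if "A \<subseteq> S" for A
  proof (rule orthocompact_if_countable_null_traces)
    show "countable (A \<inter> N)" if "negligible N" for N
      by (rule countable_subset[OF _ S(2)[OF that]]) (use \<open>A \<subseteq> S\<close> in blast)
  qed
  ultimately show ?thesis
    unfolding hereditarily_orthocompact_space_def
    by (intro exI[of _ S]) (auto simp: subtopology_subtopology Int_absorb1)
qed

end
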